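(* Let $\ell\ge 2$ be an integer and let $\alpha_s=\alpha_s^{(\ell,2)}(1,q)$ be defined by $\alpha_0=1$, $$\alpha_{3r}=q^{\frac32(\ell-3)r^2-\frac12(9-\ell)r}+q^{\frac32(\ell-3)r^2+\frac12(9-\ell)r}\quad(r\ge 1),$$ $$\alpha_{3r+1}=-q^{\frac32(\ell-3)r^2+\frac12(\ell+3)r+1}\quad(r\ge 0),\qquad \alpha_{3r-1}=-q^{\frac32(\ell-3)r^2-\frac12(\ell+3)r+1}\quad(r\ge 1).$$ Let $\beta_n^{(\ell,2)}(1,q)=\sum_{s=0}^n\frac{\alpha_s}{(q;q)_{n-s}(q;q)_{n+s}}$ for integers $n\ge 0$. Then for every integer $n\ge 0$, $$\beta_n^{(\ell,2)}(1,q)=\frac{1}{(q;q)_n(q^2;q)_n}\sum_{r\in\mathbb Z}\frac{(1-q^{6r+1})\,(q^{-n};q)_{3r}}{(1-q)\,(q^{n+2};q)_{3r}}(-1)^r q^{\frac32(\ell-6)r^2+\frac12(\ell-6)r+3nr}.$$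
   Context: $q$ is a formal variable; the identity is between rational functions of $q$. For an integer $k\ge 0$, $(a;q)_k=\prod_{j=0}^{k-1}(1-aq^j)$ and $(a;q)_{-k}=1/\prod_{j=1}^{k}(1-aq^{-j})$. For $r<0$, $1/(q^{n+2};q)_{3r}$ means $\prod_{j=1}^{-3r}(1-q^{n+2-j})$. All but finitely many terms of the bilateral sum vanish. *)

theory Defs
  imports
    "HOL-Computational_Algebra.Polynomial"
    "HOL-Computational_Algebra.Fraction_Field"
    "HOL-Library.Groups_Big_Fun"
begin

type_synonym ratfun = "rat poly fract"

definition qvar :: ratfun where
  "qvar = Fract [:0, 1:] 1"

definition qpoch :: "'a::field \<Rightarrow> 'a \<Rightarrow> int \<Rightarrow> 'a" where
  "qpoch a q k =
     (if k \<ge> 0 then (\<Prod>j<nat k. 1 - a * q ^ j)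
      else 1 / (\<Prod>j=1..nat (- k). 1 - a * q powi (- int j)))"

text \<open>The expression \<open>1 / (a; q)\<^sub>k\<close>, read for negative \<open>k\<close> as a finite product that may
  contain a zero factor.\<close>

definition qpoch_recip :: "'a::field \<Rightarrow> 'a \<Rightarrow> int \<Rightarrow> 'a" where
  "qpoch_recip a q k =
     (if k \<ge> 0 then 1 / (\<Prod>j<nat k. 1 - a * q ^ j)
      else (\<Prod>j=1..nat (- k). 1 - a * q powi (- int j)))"

text \<open>The sequences \<open>\<alpha>\<^sub>s\<close> and \<open>\<beta>\<^sub>n\<close> with superscript \<open>(l, 2)\<close> at \<open>(1, q)\<close>; \<open>alpha_simps\<close> gives the
  defining equations by residue class.
  All numerators halved below are even, see \<open>exponents_even\<close>.\<close>

definition alpha :: "int \<Rightarrow> nat \<Rightarrow> ratfun" where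
  "alpha l s =
     (if s = 0 then 1
      else if s mod 3 = 0 then
        let r = int (s div 3) in
          qvar powi ((3 * (l - 3) * r\<^sup>2 - (9 - l) * r) div 2)
          + qvar powi ((3 * (l - 3) * r\<^sup>2 + (9 - l) * r) div 2)
      else if s mod 3 = 1 then
        let r = int (s div 3) in
          - (qvar powi ((3 * (l - 3) * r\<^sup>2 + (l + 3) * r) div 2 + 1))
      else
        let r = int (s div 3) + 1 in
          - (qvar powi ((3 * (l - 3) * r\<^sup>2 - (l + 3) * r) div 2 + 1)))"

definition beta :: "int \<Rightarrow> nat \<Rightarrow> ratfun" where
  "beta l n =
     (\<Sum>s=0..n. alpha l s
        / (qpoch qvar qvar (int n - int s) * qpoch qvar qvar (int n + int s)))"

lemma exponents_even:
  fixes l r :: int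
  shows "even (3 * (l - 3) * r\<^sup>2 - (9 - l) * r)"
    and "even (3 * (l - 3) * r\<^sup>2 + (9 - l) * r)"
    and "even (3 * (l - 3) * r\<^sup>2 + (l + 3) * r)"
    and "even (3 * (l - 3) * r\<^sup>2 - (l + 3) * r)"
    and "even (3 * (l - 6) * r\<^sup>2 + (l - 6) * r)"
  by auto

lemma alpha_simps:
  shows "alpha l 0 = 1"
    and "r \<ge> 1 \<Longrightarrow> alpha l (3 * r) =
           qvar powi ((3 * (l - 3) * (int r)\<^sup>2 - (9 - l) * int r) div 2)
           + qvar powi ((3 * (l - 3) * (int r)\<^sup>2 + (9 - l) * int r) div 2)"
    and "alpha l (3 * r + 1) =
           - (qvar powi ((3 * (l - 3) * (int r)\<^sup>2 + (l + 3) * int r) div 2 + 1))"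
    and "r \<ge> 1 \<Longrightarrow> alpha l (3 * r - 1) =
           - (qvar powi ((3 * (l - 3) * (int r)\<^sup>2 - (l + 3) * int r) div 2 + 1))"
proof -
  show "alpha l 0 = 1" by (simp add: alpha_def)
  show "r \<ge> 1 \<Longrightarrow> alpha l (3 * r) =
           qvar powi ((3 * (l - 3) * (int r)\<^sup>2 - (9 - l) * int r) div 2)
           + qvar powi ((3 * (l - 3) * (int r)\<^sup>2 + (9 - l) * int r) div 2)"
    by (simp add: alpha_def Let_def)
  have "(3 * r + 1) mod 3 = 1" "(3 * r + 1) div 3 = r" by presburger+
  then show "alpha l (3 * r + 1) =
           - (qvar powi ((3 * (l - 3) * (int r)\<^sup>2 + (l + 3) * int r) div 2 + 1))"
    unfolding alpha_def Let_def by (simp del: One_nat_def)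
  assume "r \<ge> 1"
  then obtain m where r: "r = Suc m" by (cases r) auto
  then have eq: "3 * r - 1 = 3 * m + 2" by simp
  have "(3 * m + 2) mod 3 = 2" "(3 * m + 2) div 3 = m" by presburger+
  moreover have "int m + 1 = int r" using r by simp
  ultimately show "alpha l (3 * r - 1) =
           - (qvar powi ((3 * (l - 3) * (int r)\<^sup>2 - (l + 3) * int r) div 2 + 1))"
    unfolding alpha_def Let_def eq by simp
qed

lemma qvar_nonzero: "qvar \<noteq> 0"
  by (simp add: qvar_def Zero_fract_def eq_fract)

text \<open>The bilateral sum is a finite one, so \<^term>\<open>Sum_any\<close> computes its value.\<close>

lemma finite_support:
  fixes l :: int and n :: nat
  defines "t \<equiv> (\<lambda>r::int.
          (1 - qvar powi (6 * r + 1)) * qpoch (qvar powi (- int n)) qvar (3 * r) / (1 - qvar)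
          * qpoch_recip (qvar ^ (n + 2)) qvar (3 * r)
          * (- 1) powi r
          * qvar powi ((3 * (l - 6) * r\<^sup>2 + (l - 6) * r) div 2 + 3 * int n * r))"
  shows "finite {r. t r \<noteq> 0}"
proof (rule finite_subset)
  show "{r. t r \<noteq> 0} \<subseteq> {- int n - 2..int n}"
  proof (rule subsetI, rule ccontr)
    fix r assume r: "r \<in> {r. t r \<noteq> 0}" "r \<notin> {- int n - 2..int n}"
    then consider "r > int n" | "r < - int n - 2" by fastforce
    then have "t r = 0"
    proof cases
      case 1
      then have "n \<in> {..<nat (3 * r)}" by auto
      moreover have "1 - qvar powi (- int n) * qvar ^ n = 0"
        using qvar_nonzero by (simp add: power_int_minus)
      ultimately have "(\<Prod>j<nat (3 * r). 1 - qvar powi (- int n) * qvar ^ j) = 0"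
        by (intro prod_zero finite_lessThan bexI[of _ n])
      with 1 have "qpoch (qvar powi (- int n)) qvar (3 * r) = 0"
        by (simp add: qpoch_def)
      then show ?thesis by (simp add: t_def)
    next
      case 2
      then have "n + 2 \<in> {1..nat (- (3 * r))}" by auto
      moreover have "1 - qvar ^ (n + 2) * qvar powi (- int (n + 2)) = 0"
        unfolding power_int_minus power_int_of_nat
        using right_inverse[OF power_not_zero[OF qvar_nonzero, of "n + 2"]]
        by (metis diff_self)
      ultimately have "(\<Prod>j=1..nat (- (3 * r)). 1 - qvar ^ (n + 2) * qvar powi (- int j)) = 0"
        by (intro prod_zero finite_atLeastAtMost bexI[of _ "n + 2"])
      with 2 have "qpoch_recip (qvar ^ (n + 2)) qvar (3 * r) = 0"
        by (simp add: qpoch_recip_def)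
      then show ?thesis by (simp add: t_def)
    qed
    with r show False by simp
  qed
qed simp

end

theory Submission
  imports Defs
begin

text \<open>The bilateral sum matches the unfolded Bailey sum term by term. With \<open>a\<close> for
  \<open>unfolded_alpha l\<close>, we have \<open>\<alpha>\<^sub>s = a s + a (- s)\<close> for \<open>s \<ge> 1\<close>, so that \<open>\<beta>\<^sub>n\<close> is the sum of
  \<open>a s / ((q)\<^bsub>n-s\<^esub> (q)\<^bsub>n+s\<^esub>)\<close> over all integers \<open>s\<close>, where \<open>a\<close> vanishes on the class \<open>2\<close> modulo \<open>3\<close>.
  The contributions of \<open>s = 3r\<close> and \<open>s = 3r + 1\<close> combine to the \<open>r\<close>-th summand because
  \<open>(1 - q\<^bsup>n+3r+1\<^esup>) - q\<^bsup>6r+1\<^esup> (1 - q\<^bsup>n-3r\<^esup>) = 1 - q\<^bsup>6r+1\<^esup>\<close>.\<close>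

section \<open>q-Pochhammer symbols with integer index\<close>

text \<open>The value 0 at negative \<open>k\<close> is the usual convention for
  \<open>1 / (q;q)_k\<close>; it makes the two-sided Bailey sum finite.\<close>

definition recip_qfact :: "'a::field \<Rightarrow> int \<Rightarrow> 'a" where
  "recip_qfact q k = (if k < 0 then 0 else 1 / (\<Prod>j<nat k. 1 - q ^ Suc j))"

text \<open>For \<open>k < 0\<close> the factor is cancelled from a denominator, where division by
  zero would make the right side 0; hence the hypothesis. For \<open>k \<ge> 0\<close> it is
  appended to the product.\<close>

lemma qpoch_succ:
  fixes a q :: "'a::field"
  assumes "k < 0 \<Longrightarrow> a * q powi k \<noteq> 1"
  shows "qpoch a q (k + 1) = (1 - a * q powi k) * qpoch a q k"
proof (cases "k \<ge> 0")
  case True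
  then obtain m where k: "k = int m" by (rule nonneg_int_cases)
  have "qpoch a q (int i) = (\<Prod>j<i. 1 - a * q ^ j)" for i
    by (simp add: qpoch_def)
  note this [of m] this [of "Suc m"]
  moreover have "k + 1 = int (Suc m)" by (simp add: k)
  ultimately show ?thesis
    by (simp only: k power_int_of_nat prod.lessThan_Suc mult.commute)
next
  case False
  then obtain m where "nat (- k) = Suc m" by (cases "nat (- k)") auto
  then have k: "k = - int (Suc m)" by linarith
  have ne: "1 - a * q powi (- int (Suc m)) \<noteq> 0"
    using assms False k by auto
  have succ: "qpoch a q (k + 1) = 1 / (\<Prod>j=1..m. 1 - a * q powi (- int j))"
    by (cases "m = 0") (simp_all add: qpoch_def k)
  have pred: "qpoch a q k
      = 1 / ((\<Prod>j=1..m. 1 - a * q powi (- int j)) * (1 - a * q powi (- int (Suc m))))"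
    by (simp add: qpoch_def k nat_add_distrib del: of_nat_Suc)
  have cancel: "1 / x = y * (1 / (x * y))" if "y \<noteq> 0" for x y :: 'a
    using that by simp
  show ?thesis
    unfolding succ pred unfolding k by (rule cancel [OF ne])
qed

text \<open>This is the reciprocal of \<open>qpoch_succ\<close>, except where the factor is zero:
  then \<open>k < 0\<close>, and the product on the left contains that factor.\<close>

lemma qpoch_recip_pred:
  assumes "k \<ge> 0 \<Longrightarrow> a * q powi k \<noteq> 1"
  shows "qpoch_recip a q k = (1 - a * q powi k) * qpoch_recip a q (k + 1)"
proof (cases "a * q powi k = 1")
  case True
  with assms have "k < 0" by force
  then have "(\<Prod>j=1..nat (- k). 1 - a * q powi (- int j)) = 0"
    using True by (intro prod_zero bexI[of _ "nat (- k)"]) auto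
  moreover have "\<not> 0 \<le> k" using \<open>k < 0\<close> by simp
  ultimately show ?thesis
    unfolding True by (simp only: qpoch_recip_def if_False diff_self mult_zero_left)
next
  case False
  moreover have "qpoch_recip a q i = 1 / qpoch a q i" for i \<comment> \<open>also when both sides are \<open>0\<close>\<close>
    by (simp add: qpoch_recip_def qpoch_def)
  ultimately show ?thesis using qpoch_succ[of k a q] by simp
qed

section \<open>Reduction to reciprocal q-factorials, for \<open>q\<close> not a root of
  unity\<close>

context
  fixes q :: "'a::field"
  assumes nonzero: "q \<noteq> 0"
    and power_neq_1: "\<forall>k>0. q ^ k \<noteq> 1"
begin

lemma powi_eq_1_iff: "q powi k = 1 \<longleftrightarrow> k = 0"
proof
  assume *: "q powi k = 1"
  show "k = 0"
  proof (rule ccontr)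
    assume "k \<noteq> 0"
    then have "q ^ nat \<bar>k\<bar> \<noteq> 1" by (intro power_neq_1 [rule_format]) auto
    with * show False by (auto simp: power_int_def power_inverse split: if_splits)
  qed
qed simp

text \<open>The convention at negative arguments fits: at \<open>k = 0\<close> the factor
  \<open>1 - q powi k\<close> vanishes, just as the left side becomes 0.\<close>

lemma recip_qfact_pred: "recip_qfact q (k - 1) = (1 - q powi k) * recip_qfact q k"
proof (cases "k > 0")
  case True
  then obtain m where k: "k = int (Suc m)"
    by (metis gr0_implies_Suc zero_less_imp_eq_int)
  have "q ^ Suc m \<noteq> 1" by (rule power_neq_1 [rule_format]) simp
  then have "1 - q ^ Suc m \<noteq> 0" by (metis eq_iff_diff_eq_0)
  moreover have "nat (int (Suc m)) = Suc m" "nat (int (Suc m) - 1) = m" by auto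
  ultimately show ?thesis
    unfolding recip_qfact_def k
    by (simp del: power_Suc of_nat_Suc add: power_int_of_nat)
next
  case False
  then show ?thesis by (cases "k = 0") (auto simp: recip_qfact_def)
qed

text \<open>For \<open>k < 0\<close> the factor at \<open>j = 1\<close> is zero, so division by zero
  gives \<open>qpoch q q k\<close> the value 0, and its reciprocal is again 0.\<close>

lemma inverse_qpoch_self: "1 / qpoch q q k = recip_qfact q k"
proof (cases "k < 0")
  case True
  then have "(\<Prod>j=1..nat (- k). 1 - q * q powi (- int j)) = 0"
    using nonzero by (intro prod_zero bexI[of _ 1]) (auto simp: power_int_minus)
  moreover have "\<not> 0 \<le> k" using True by simp
  ultimately show ?thesis
    using True by (simp only: qpoch_def recip_qfact_def if_True if_False div_by_0)
qed (simp add: qpoch_def recip_qfact_def)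

text \<open>Both sides agree at \<open>m = 0\<close> and gain the factor
  \<open>1 - q powi (m - int n)\<close> when \<open>m\<close> grows by 1.\<close>

lemma qpoch_neg_power:
  "recip_qfact q (int n) * qpoch (q powi (- int n)) q m
     = (- 1) powi m * q powi (m * (m - 1) div 2 - int n * m) * recip_qfact q (int n - m)"
    (is "?L m = ?R m")
proof -
  let ?f = "\<lambda>m. 1 - q powi (m - int n)"
  have L: "?L (k + 1) = ?f k * ?L k" for k
    using qpoch_succ[of k "q powi (- int n)" q] powi_eq_1_iff[of "k - int n"] nonzero
    by (simp add: power_int_add[symmetric])
  have R: "?R (k + 1) = ?f k * ?R k" for k
  proof -
    have "(k + 1) * (k + 1 - 1) = k * (k - 1) + k * 2" by (simp add: algebra_simps)
    then have "(k + 1) * (k + 1 - 1) div 2 = k * (k - 1) div 2 + k" by simp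
    then have e: "(k + 1) * (k + 1 - 1) div 2 - int n * (k + 1)
        = (k * (k - 1) div 2 - int n * k) + (k - int n)" by (simp add: algebra_simps)
    \<comment> \<open>The power of \<open>q\<close> reverses the exponent in the factor from
      \<open>recip_qfact\<close>; the resulting sign is the one from
      \<open>(- 1) powi m\<close>.\<close>
    have f: "q powi (k - int n) * (1 - q powi (int n - k)) = - ?f k"
      using nonzero by (simp add: algebra_simps power_int_add[symmetric])
    have F: "recip_qfact q (int n - (k + 1)) = (1 - q powi (int n - k)) * recip_qfact q (int n - k)"
      using recip_qfact_pred[of "int n - k"] by (simp add: algebra_simps)
    have sign: "(- 1 :: 'a) powi (k + 1) = - ((- 1) powi k)"
      by (simp add: power_int_add)
    have pow: "q powi (k * (k - 1) div 2 - int n * k + (k - int n))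
        = q powi (k * (k - 1) div 2 - int n * k) * q powi (k - int n)"
      using nonzero by (simp only: power_int_add simp_thms)
    have "?R (k + 1) = - ((- 1) powi k * q powi (k * (k - 1) div 2 - int n * k)
        * (q powi (k - int n) * (1 - q powi (int n - k))) * recip_qfact q (int n - k))"
      unfolding e F sign pow by (simp only: mult.assoc mult_minus_left)
    also have "\<dots> = ?f k * ?R k"
      unfolding f by (simp only: mult_ac mult_minus_left mult_minus_right minus_minus)
    finally show ?thesis .
  qed
  show ?thesis
  proof (induction m rule: int_induct[where k = 0])
    case base
    show ?case by (simp add: qpoch_def)
  next
    case (step1 i)
    then show ?case by (simp only: L R)
  next
    case (step2 i)
    \<comment> \<open>Going down, the factor has to be cancelled; it is nonzero because
      \<open>i - 1 - int n < 0\<close>.\<close>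
    then have "?f (i - 1) \<noteq> 0" using powi_eq_1_iff[of "i - 1 - int n"] by auto
    moreover have "i - 1 + 1 = i" by simp
    then have "?f (i - 1) * ?L (i - 1) = ?f (i - 1) * ?R (i - 1)"
      using step2(2) L[of "i - 1"] R[of "i - 1"] by metis
    ultimately show ?case by (metis mult_left_cancel)
  qed
qed

text \<open>For \<open>m \<ge> 0\<close> this is the regrouping
  \<open>(q;q)_{n+m+1} = (1 - q) (q^2;q)_n (q^{n+2};q)_m\<close>. A common recurrence in
  \<open>m\<close> covers all integers, including the zeros at
  \<open>m \<le> - n - 2\<close>.\<close>

lemma qpoch_recip_shift:
  "1 / qpoch (q\<^sup>2) q (int n) * qpoch_recip (q ^ (n + 2)) q m = (1 - q) * recip_qfact q (int n + m + 1)"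
    (is "?L m = ?R m")
proof -
  let ?f = "\<lambda>m. 1 - q powi (int n + m + 2)"
  have e: "q ^ (n + 2) * q powi k = q powi (int n + k + 2)" for k
    using nonzero by (simp add: power_int_add power2_eq_square power_int_of_nat)
  have L: "?L k = ?f k * ?L (k + 1)" for k
    using qpoch_recip_pred[of k "q ^ (n + 2)" q] powi_eq_1_iff[of "int n + k + 2"] unfolding e by simp
  have R: "?R k = ?f k * ?R (k + 1)" for k
  proof -
    have "recip_qfact q (int n + k + 1) = ?f k * recip_qfact q (int n + (k + 1) + 1)"
      using recip_qfact_pred[of "int n + k + 2"] by (simp add: algebra_simps)
    then show ?thesis by simp
  qed
  show ?thesis
  proof (induction m rule: int_induct[where k = 0])
    case base
    have "1 - q \<noteq> 0" using power_neq_1 [rule_format, of 1] by auto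
    then show ?case
      by (simp add: qpoch_recip_def qpoch_def recip_qfact_def nat_add_distrib
          prod.lessThan_Suc_shift power2_eq_square mult.assoc del: prod.lessThan_Suc)
  next
    case (step1 i)
    \<comment> \<open>The recurrence expresses the value at \<open>i\<close> by that at
      \<open>i + 1\<close>, so here the upward step cancels a factor, nonzero as
      \<open>int n + i + 2 > 0\<close>.\<close>
    then have "?f i \<noteq> 0" using powi_eq_1_iff[of "int n + i + 2"] by auto
    moreover have "?f i * ?L (i + 1) = ?f i * ?R (i + 1)"
      using step1(2) L[of i] R[of i] by metis
    ultimately show ?case by (metis mult_left_cancel)
  next
    case (step2 i)
    have "i - 1 + 1 = i" by simp
    then show ?case using step2(2) L[of "i - 1"] R[of "i - 1"] by metis
  qed
qed

end

section \<open>Unfolding and regrouping sums over the integers\<close>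

lemma sum_int_group_3:
  fixes f :: "int \<Rightarrow> 'a::comm_monoid_add"
  assumes "a \<le> b"
  shows "(\<Sum>s\<in>{3 * a..<3 * b}. f s) = (\<Sum>r\<in>{a..<b}. f (3 * r) + f (3 * r + 1) + f (3 * r + 2))"
  using assms
proof (induction b rule: int_ge_induct)
  case (step i)
  have insert: "{x..<y + 1} = insert y {x..<y}" if "x \<le> y" for x y :: int
    using that by auto
  have "3 * (i + 1) = 3 * i + 1 + 1 + 1" "3 * a \<le> 3 * i" "3 * a \<le> 3 * i + 1" "3 * a \<le> 3 * i + 1 + 1"
    using step.hyps by simp_all
  then have "{3 * a..<3 * (i + 1)} = insert (3 * i + 1 + 1) (insert (3 * i + 1) (insert (3 * i) {3 * a..<3 * i}))"
    by (simp only: insert)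
  moreover have "{a..<i + 1} = insert i {a..<i}"
    using step.hyps by (rule insert)
  ultimately show ?case using step.IH by (simp add: ac_simps)
qed simp

lemma sum_symmetric_int:
  fixes f :: "int \<Rightarrow> 'a::comm_monoid_add"
  shows "(\<Sum>s\<in>{- int n..int n}. f s) = f 0 + (\<Sum>s=1..n. f (int s) + f (- int s))"
proof (induction n)
  case (Suc n)
  have "{- int (Suc n)..int (Suc n)} = {- int (Suc n), int (Suc n)} \<union> {- int n..int n}" by auto
  then show ?case using Suc by (simp add: ac_simps del: of_nat_Suc)
qed simp

text \<open>Separates the rearrangement of sums from the q-identities, which enter only through
  \<open>t_eq\<close>. Here \<open>F\<close> stands for the reciprocal q-factorial.\<close>

locale unfolded_bailey_sum =
  fixes \<alpha> :: "nat \<Rightarrow> 'a::field" and a F :: "int \<Rightarrow> 'a" and n :: nat and t :: "int \<Rightarrow> 'a"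
  assumes F_neg: "k < 0 \<Longrightarrow> F k = 0"
    and \<alpha>_0: "\<alpha> 0 = a 0"
    and \<alpha>_pos: "s \<ge> 1 \<Longrightarrow> \<alpha> s = a (int s) + a (- int s)"
    and a_class_2: "a (3 * r + 2) = 0"
    and t_eq: "t r = a (3 * r) * (F (int n - 3 * r) * F (int n + 3 * r))
      + a (3 * r + 1) * (F (int n - (3 * r + 1)) * F (int n + (3 * r + 1)))"
begin

lemma sum_eq: "(\<Sum>s=0..n. \<alpha> s * (F (int n - int s) * F (int n + int s))) = Sum_any t"
proof -
  \<comment> \<open>Wide enough that the blocks of three with \<open>- N \<le> r < N\<close> cover
    all \<open>s\<close> from \<open>- n\<close> to \<open>n\<close>, and that \<open>u\<close>
    vanishes at \<open>3 * r\<close> and \<open>3 * r + 1\<close> for every other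
    \<open>r\<close>.\<close>
  define N where "N = int n + 2"
  define u where "u s = a s * (F (int n - s) * F (int n + s))" for s
  have u_0: "u s = 0" if "s < - int n \<or> s > int n" for s
    using that by (auto simp: u_def F_neg)
  have t_u: "t r = u (3 * r) + u (3 * r + 1)" for r
    by (simp only: t_eq u_def)
  have "(\<Sum>s=1..n. \<alpha> s * (F (int n - int s) * F (int n + int s))) = (\<Sum>s=1..n. u (int s) + u (- int s))"
    by (rule sum.cong) (simp_all add: \<alpha>_pos u_def algebra_simps)
  moreover have "{0..n} = insert 0 {1..n}" by auto
  ultimately have "(\<Sum>s=0..n. \<alpha> s * (F (int n - int s) * F (int n + int s))) = sum u {- int n..int n}"
    by (simp add: sum_symmetric_int \<alpha>_0 u_def)
  also have "\<dots> = sum u {3 * (- N)..<3 * N}"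
    by (rule sum.mono_neutral_left, simp, force simp: N_def, intro ballI u_0, auto)
  also have "\<dots> = (\<Sum>r\<in>{- N..<N}. u (3 * r) + u (3 * r + 1) + u (3 * r + 2))"
    by (rule sum_int_group_3) (simp add: N_def)
  also have "\<dots> = sum t {- N..<N}"
    by (simp add: t_u u_def a_class_2)
  also have "\<dots> = Sum_any t"
  proof (rule Sum_any.expand_superset [symmetric])
    show "{r. t r \<noteq> 0} \<subseteq> {- N..<N}"
    proof (intro subsetI, rule ccontr)
      fix r
      assume r: "r \<in> {r. t r \<noteq> 0}" "r \<notin> {- N..<N}"
      then have "u (3 * r) = 0" "u (3 * r + 1) = 0"
        unfolding N_def atLeastLessThan_iff by (intro u_0, linarith)+
      with r(1) show False by (simp add: t_u)
    qed
  qed simp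
  finally show ?thesis .
qed

end

section \<open>Specialization to rational functions and the given sequences\<close>

lemma qvar_power_neq_1: "\<forall>k>0. qvar ^ k \<noteq> 1"
proof (intro allI impI)
  fix k :: nat
  assume "k > 0"
  have "qvar ^ k = Fract (monom 1 k) 1"
    by (induction k) (simp_all add: qvar_def One_fract_def monom_Suc flip: one_pCons)
  moreover have "monom (1 :: rat) k \<noteq> 1"
    using \<open>k > 0\<close> by (metis degree_1 degree_monom_eq less_numeral_extra(3) one_neq_zero)
  ultimately show "qvar ^ k \<noteq> 1" by (simp add: One_fract_def eq_fract)
qed

lemmas qvar_recip_qfact_pred = recip_qfact_pred [OF qvar_nonzero qvar_power_neq_1]
  and qvar_inverse_qpoch_self = inverse_qpoch_self [OF qvar_nonzero qvar_power_neq_1]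
  and qvar_qpoch_neg_power = qpoch_neg_power [OF qvar_nonzero qvar_power_neq_1]
  and qvar_qpoch_recip_shift = qpoch_recip_shift [OF qvar_nonzero qvar_power_neq_1]

text \<open>Negative \<open>s\<close> supply the remaining monomials: \<open>r\<close> and
  \<open>- r\<close> in class 0 give the two powers in \<open>alpha l (3 * r)\<close>, and class 1
  at \<open>- r\<close> gives \<open>alpha l (3 * r - 1)\<close>, since
  \<open>-(3 * r - 1) = 3 * (- r) + 1\<close>.\<close>

definition unfolded_alpha :: "int \<Rightarrow> int \<Rightarrow> ratfun" where
  "unfolded_alpha l s =
     (let r = s div 3 in
      if s mod 3 = 0 then qvar powi ((3 * (l - 3) * r\<^sup>2 - (9 - l) * r) div 2)
      else if s mod 3 = 1 then - (qvar powi ((3 * (l - 3) * r\<^sup>2 + (l + 3) * r) div 2 + 1))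
      else 0)"

lemma unfolded_alpha_simps:
  "unfolded_alpha l (3 * r) = qvar powi ((3 * (l - 3) * r\<^sup>2 - (9 - l) * r) div 2)"
  "unfolded_alpha l (3 * r + 1) = - (qvar powi ((3 * (l - 3) * r\<^sup>2 + (l + 3) * r) div 2 + 1))"
  "unfolded_alpha l (3 * r + 2) = 0"
proof -
  have "(3 * r + 1) mod 3 = 1" "(3 * r + 1) div 3 = r" "(3 * r + 2) mod 3 = 2"
    by simp_all
  then show "unfolded_alpha l (3 * r) = qvar powi ((3 * (l - 3) * r\<^sup>2 - (9 - l) * r) div 2)"
    "unfolded_alpha l (3 * r + 1) = - (qvar powi ((3 * (l - 3) * r\<^sup>2 + (l + 3) * r) div 2 + 1))"
    "unfolded_alpha l (3 * r + 2) = 0"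
    by (simp_all add: unfolded_alpha_def Let_def)
qed

text \<open>The prefactor is kept inside so that its two q-factorials can be absorbed by
  \<open>qpoch_neg_power\<close> and \<open>qpoch_recip_shift\<close> term by term.\<close>

definition bilateral_summand :: "int \<Rightarrow> nat \<Rightarrow> int \<Rightarrow> ratfun" where
  "bilateral_summand l n r =
     1 / (qpoch qvar qvar (int n) * qpoch (qvar\<^sup>2) qvar (int n)) *
      ((1 - qvar powi (6 * r + 1)) * qpoch (qvar powi (- int n)) qvar (3 * r) / (1 - qvar)
          * qpoch_recip (qvar ^ (n + 2)) qvar (3 * r)
          * (- 1) powi r
          * qvar powi ((3 * (l - 6) * r\<^sup>2 + (l - 6) * r) div 2 + 3 * int n * r))"

interpretation unfolded_bailey_sum "alpha l" "unfolded_alpha l" "recip_qfact qvar" n "bilateral_summand l n"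
  for l n
proof
  show "recip_qfact qvar k = 0" if "k < 0" for k
    using that by (simp add: recip_qfact_def)
  show "alpha l 0 = unfolded_alpha l 0"
    using unfolded_alpha_simps(1)[of l 0] by (simp add: alpha_simps(1))
  show "unfolded_alpha l (3 * r + 2) = 0" for r
    by (rule unfolded_alpha_simps)
  show "alpha l s = unfolded_alpha l (int s) + unfolded_alpha l (- int s)" if "s \<ge> 1" for s
  proof -
    obtain r m where m: "s = 3 * r + m" "m < 3"
      by (rule that [of "s div 3" "s mod 3"]) simp_all
    from m(2) have "m = 0 \<or> m = 1 \<or> m = 2" by auto
    then have "s = 3 * r \<or> s = 3 * r + 1 \<or> s = 3 * (r + 1) - 1"
      unfolding m(1) by auto
    then show ?thesis
    proof (elim disjE)
      assume "s = 3 * r"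
      moreover from this that have "r \<ge> 1" by simp
      ultimately show ?thesis
        using unfolded_alpha_simps(1)[of l "int r"] unfolded_alpha_simps(1)[of l "- int r"]
        by (simp add: alpha_simps)
    next
      assume s: "s = 3 * r + 1"
      \<comment> \<open>Here \<open>- s\<close> falls into class 2, where
        \<open>unfolded_alpha\<close> vanishes.\<close>
      have "int s = 3 * int r + 1" "- int s = 3 * (- int r - 1) + 2" unfolding s by simp_all
      then show ?thesis
        by (simp only: s alpha_simps unfolded_alpha_simps add_0_right)
    next
      assume s: "s = 3 * (r + 1) - 1"
      \<comment> \<open>The roles are exchanged: \<open>s\<close> is in class 2 and
        \<open>- s\<close> in class 1.\<close>
      then have e: "int s = 3 * int r + 2" "- int s = 3 * (- int (r + 1)) + 1" by simp_all
      have "unfolded_alpha l (int s) = 0"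
        unfolding e(1) by (rule unfolded_alpha_simps)
      moreover have "alpha l s = - (qvar powi ((3 * (l - 3) * (int (r + 1))\<^sup>2 - (l + 3) * int (r + 1)) div 2 + 1))"
        unfolding s by (rule alpha_simps) simp
      moreover have "unfolded_alpha l (- int s) = \<dots>"
        unfolding e(2) unfolded_alpha_simps
        by (simp only: power2_minus mult_minus_right add_uminus_conv_diff)
      ultimately show ?thesis by (simp only: add_0_left)
    qed
  qed
  show "bilateral_summand l n r
      = unfolded_alpha l (3 * r) * (recip_qfact qvar (int n - 3 * r) * recip_qfact qvar (int n + 3 * r))
      + unfolded_alpha l (3 * r + 1)
        * (recip_qfact qvar (int n - (3 * r + 1)) * recip_qfact qvar (int n + (3 * r + 1)))" for r
  proof -
    let ?F = "recip_qfact qvar"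
    \<comment> \<open>\<open>?g\<close> is the exponent of \<open>unfolded_alpha\<close> at
      \<open>3 * r\<close>, \<open>?m\<close> the one produced by \<open>qpoch_neg_power\<close> and
      \<open>?x\<close> the one in the summand; the match is \<open>?m + ?x = ?g\<close>.\<close>
    let ?g = "(3 * (l - 3) * r\<^sup>2 - (9 - l) * r) div 2"
    let ?m = "3 * r * (3 * r - 1) div 2 - int n * (3 * r)"
    let ?x = "(3 * (l - 6) * r\<^sup>2 + (l - 6) * r) div 2 + 3 * int n * r"
    let ?B = "1 - qvar powi (6 * r + 1)" and ?C = "qpoch (qvar powi (- int n)) qvar (3 * r)"
      and ?D = "1 - qvar" and ?E = "qpoch_recip (qvar ^ (n + 2)) qvar (3 * r)"
      and ?S = "(- 1 :: ratfun) powi r"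
    let ?X = "qvar powi ?x"
    have arith1: "(x - int n * (3 * r)) + (y + 3 * int n * r) = z" if "x + y = z" for x y z
      using that by simp
    have arith2: "x div 2 + 1 = y div 2 + (c + 1)" if "x = y + c * 2" for x y c :: int
      using that by simp
    have cancel: "b / d * (s * p * x) * (d * y) * s' * p' = b * (s * s') * (p * p') * (x * y)"
      if "d \<noteq> 0" for b d s p x y s' p' :: ratfun
      using that by simp
    have D: "?D \<noteq> 0" using qvar_power_neq_1 [rule_format, of 1] by auto
    have "even (3 * r * (3 * r - 1))" by auto
    then have "3 * r * (3 * r - 1) div 2 + (3 * (l - 6) * r\<^sup>2 + (l - 6) * r) div 2
        = (3 * r * (3 * r - 1) + (3 * (l - 6) * r\<^sup>2 + (l - 6) * r)) div 2"
      by (rule div_plus_div_distrib_dvd_left[symmetric])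
    also have "3 * r * (3 * r - 1) + (3 * (l - 6) * r\<^sup>2 + (l - 6) * r)
        = 3 * (l - 3) * r\<^sup>2 - (9 - l) * r" by (simp add: algebra_simps power2_eq_square)
    finally have g: "?m + ?x = ?g" by (rule arith1)
    \<comment> \<open>The exponent of \<open>unfolded_alpha\<close> at \<open>3 * r + 1\<close>
      exceeds \<open>?g\<close> by \<open>6 * r + 1\<close>, the exponent in
      \<open>?B\<close>.\<close>
    have "3 * (l - 3) * r\<^sup>2 + (l + 3) * r = (3 * (l - 3) * r\<^sup>2 - (9 - l) * r) + (6 * r) * 2"
      by (simp add: algebra_simps)
    then have f: "(3 * (l - 3) * r\<^sup>2 + (l + 3) * r) div 2 + 1 = ?g + (6 * r + 1)" by (rule arith2)
    have sign: "(- 1 :: ratfun) powi (3 * r) * ?S = 1"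
      by (simp flip: power_int_add)
    have "bilateral_summand l n r
        = ?B / ?D * (?F (int n) * ?C) * (1 / qpoch (qvar\<^sup>2) qvar (int n) * ?E) * ?S * ?X"
      unfolding bilateral_summand_def by (simp flip: qvar_inverse_qpoch_self)
    also have "\<dots> = ?B / ?D * ((- 1) powi (3 * r) * qvar powi ?m * ?F (int n - 3 * r))
        * (?D * ?F (int n + 3 * r + 1)) * ?S * ?X"
      unfolding qvar_qpoch_neg_power qvar_qpoch_recip_shift ..
    also have "\<dots> = ?B * ((- 1) powi (3 * r) * ?S) * (qvar powi ?m * ?X)
        * (?F (int n - 3 * r) * ?F (int n + 3 * r + 1))"
      by (rule cancel [OF D])
    also have "\<dots> = ?B * qvar powi ?g * (?F (int n - 3 * r) * ?F (int n + 3 * r + 1))"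
      unfolding sign g[symmetric] using qvar_nonzero by (simp only: power_int_add mult_1_right simp_thms)
    finally have lhs: "bilateral_summand l n r
        = ?B * qvar powi ?g * (?F (int n - 3 * r) * ?F (int n + 3 * r + 1))" .
    \<comment> \<open>Both Bailey terms are brought to the common factor
      \<open>?F (int n - 3 * r) * ?F (int n + 3 * r + 1)\<close>.\<close>
    have F1: "?F (int n + 3 * r) = (1 - qvar powi (int n + 3 * r + 1)) * ?F (int n + 3 * r + 1)"
      using qvar_recip_qfact_pred[of "int n + 3 * r + 1"] by simp
    have F2: "?F (int n - (3 * r + 1)) = (1 - qvar powi (int n - 3 * r)) * ?F (int n - 3 * r)"
      using qvar_recip_qfact_pred[of "int n - 3 * r"] by (simp add: algebra_simps)
    have F3: "?F (int n + (3 * r + 1)) = ?F (int n + 3 * r + 1)" by (simp add: add.assoc)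
    have "6 * r + 1 + (int n - 3 * r) = int n + 3 * r + 1" by simp
    then have "qvar powi (int n + 3 * r + 1) = qvar powi (6 * r + 1) * qvar powi (int n - 3 * r)"
      using power_int_add[of qvar "6 * r + 1" "int n - 3 * r"] qvar_nonzero by metis
    then have "(1 - qvar powi (int n + 3 * r + 1)) - qvar powi (6 * r + 1) * (1 - qvar powi (int n - 3 * r)) = ?B"
      by (simp add: right_diff_distrib)
    then have "?B * qvar powi ?g * (?F (int n - 3 * r) * ?F (int n + 3 * r + 1))
        = ((1 - qvar powi (int n + 3 * r + 1)) - qvar powi (6 * r + 1) * (1 - qvar powi (int n - 3 * r)))
          * qvar powi ?g * (?F (int n - 3 * r) * ?F (int n + 3 * r + 1))" by simp
    also have "\<dots> = qvar powi ?g * (?F (int n - 3 * r) * ?F (int n + 3 * r))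
        - (qvar powi ?g * qvar powi (6 * r + 1)) * (?F (int n - (3 * r + 1)) * ?F (int n + (3 * r + 1)))"
      unfolding F1 F2 F3 by (simp only: left_diff_distrib right_diff_distrib mult_ac)
    also have "qvar powi ?g * qvar powi (6 * r + 1) = qvar powi (?g + (6 * r + 1))"
      using qvar_nonzero by (simp only: power_int_add simp_thms)
    finally show ?thesis
      unfolding lhs unfolded_alpha_simps f by simp
  qed
qed

theorem mainTheorem3:
  fixes l :: int and n :: nat
  assumes "l \<ge> 2"
  shows "beta l n =
    1 / (qpoch qvar qvar (int n) * qpoch (qvar\<^sup>2) qvar (int n))
      * Sum_any (\<lambda>r::int.
          (1 - qvar powi (6 * r + 1)) * qpoch (qvar powi (- int n)) qvar (3 * r) / (1 - qvar)
          * qpoch_recip (qvar ^ (n + 2)) qvar (3 * r)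
          * (- 1) powi r
          * qvar powi ((3 * (l - 6) * r\<^sup>2 + (l - 6) * r) div 2 + 3 * int n * r))"
    (is "_ = ?A * Sum_any ?t")
proof -
  have "beta l n
      = (\<Sum>s=0..n. alpha l s * (recip_qfact qvar (int n - int s) * recip_qfact qvar (int n + int s)))"
    by (simp add: beta_def flip: qvar_inverse_qpoch_self)
  also have "\<dots> = (\<Sum>r. ?A * ?t r)"
    unfolding sum_eq bilateral_summand_def ..
  also have "\<dots> = ?A * Sum_any ?t"
    \<comment> \<open>Finite support is essential: \<open>Sum_any\<close> is 0 by default on
      infinite support.\<close>
    by (rule Sum_any_right_distrib [OF finite_support, symmetric])
  finally show ?thesis .
qed

end
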